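(* Consider the $N$-player difference game with inequality constraints NZDG and the optimal control problem OCP described in the context, and suppose the standing assumptions (1)–(4) listed there hold. Assume that the cost functions $\{P_k,\ k\in\mathcal K\}$ of OCP satisfy, for every $i\in\mathcal N$, $$\frac{\partial P_k}{\partial u_k^i}=\frac{\partial gu_k^i}{\partial u_k^i},\qquad \frac{\partial P_k}{\partial v_k^i}=\frac{\partial gv_k^i}{\partial v_k^i},\qquad \frac{\partial P_k}{\partial x_k}=\frac{\partial g_k^i}{\partial x_k},\qquad k\in\mathcal K\setminus\{K\},$$ $$\frac{\partial P_K}{\partial x_K}=\frac{\partial g_K^i}{\partial x_K},\qquad \frac{\partial P_K}{\partial v_K^i}=\frac{\partial g_K^i}{\partial v_K^i}$$ (identically in all arguments). Let the admissible pair $(\tilde{\mathbf u}^*,\tilde{\mathbf v}^* )$ be an optimal solution of OCP. Then $(\tilde{\mathbf u}^*,\tilde{\mathbf v}^* )$ is an open-loop Nash equilibrium of NZDG; that is, NZDG is an open-loop potential difference game with potential functions $\{P_k,\ k\in\mathcal K\}$.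
   Context: Players $\mathcal N=\{1,\dots,N\}$, time periods $\mathcal K=\{0,1,\dots,K\}$. At time $k$ player $i$ chooses $u_k^i\in U_k^i\subset\mathbb R^{m_i}$ (for $k\in\mathcal K\setminus\{K\}$) and $v_k^i\in V_k^i\subset\mathbb R^{s_i}$ (for $k\in\mathcal K$). Put $m=\sum_i m_i$, $s=\sum_i s_i$, $\mathbf u_k=(u_k^1,\dots,u_k^N)\in\mathbb R^m$, $\mathbf v_k=(v_k^1,\dots,v_k^N)\in\mathbb R^s$. The state $x_k\in X_k\subset\mathbb R^n$ ($X_k$ the set of admissible states at time $k$) evolves by $$x_{k+1}=f_k(x_k,\mathbf u_k),\quad k\in\mathcal K\setminus\{K\},\quad x_0\text{ given},$$ and the players face the coupled constraints $$h_k(x_k,\mathbf v_k)\ge 0,\quad \mathbf v_k\ge 0,\quad k\in\mathcal K$$ (componentwise, $h_k$ vector valued). A strategy of player $i$ is a pair of time sequences (open-loop) $\tilde u^i=\{u_k^i\}_{k\in\mathcal K\setminus\{K\}}$, $\tilde v^i=\{v_k^i\}_{k\in\mathcal K}$; $-i$ denotes the players other than $i$, $\tilde{\mathbf u}=(\tilde u^i,\tilde u^{-i})$, $\tilde{\mathbf v}=(\tilde v^i,\tilde v^{-i})$. A pair $(\tilde{\mathbf u},\tilde{\mathbf v})$ is admissible if the actions lie in the action sets and the constraints hold along the state trajectory generated by $\tilde{\mathbf u}$. NZDG: player $i$ minimizes over $(\tilde u^i,\tilde v^i)$ the cost $J^i(x_0,\tilde{\mathbf u},\tilde{\mathbf v})=g_K^i(x_K,\mathbf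 v_K)+\sum_{k=0}^{K-1}g_k^i(x_k,\mathbf u_k,\mathbf v_k)$ subject to the dynamics and constraints. An admissible profile $(\tilde{\mathbf u}^*,\tilde{\mathbf v}^* )$ is an open-loop Nash equilibrium if for every $i$, $(\tilde u^{i*},\tilde v^{i*})$ minimizes $J^i(x_0,(\tilde u^i,\tilde u^{-i*}),(\tilde v^i,\tilde v^{-i*}))$ over all $(\tilde u^i,\tilde v^i)$ such that $((\tilde u^i,\tilde u^{-i*}),(\tilde v^i,\tilde v^{-i*}))$ is admissible (constraints evaluated along the trajectory generated by $(\tilde u^i,\tilde u^{-i*})$). OCP: minimize over admissible $(\tilde{\mathbf u},\tilde{\mathbf v})$ (same dynamics, same constraints) $J(x_0,\tilde{\mathbf u},\tilde{\mathbf v})=P_K(x_K,\mathbf v_K)+\sum_{k=0}^{K-1}P_k(x_k,\mathbf u_k,\mathbf v_k)$, where $P_k:\mathbb R^n\times\mathbb R^m\times\mathbb R^s\to\mathbb R$ ($k<K$) and $P_K:\mathbb R^n\times\mathbb R^s\to\mathbb R$ are twice continuously differentiable. NZDG is an open-loop potential difference game (OLPDG) if there exist cost functions $\{P_k,\ k\in\mathcal K\}$ such that the optimal solution of OCP is an open-loop Nash equilibrium of NZDG; such $P_k$ are called potential (cost) functions. Standing assumptions. (1) The sets $U_k^i$ are such that the sets of state vectors $X_k$, $k\in\mathcal K$, are convex, and the feasible action sets $V_k^i(x_k,v_k^{-i})=\{v_k^i\in\mathbb R^{s_i}: h_k(x_k,\mathbf v_k)\ge 0,\ \mathbf v_k\ge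 0\}$, $x_k\in X_k$, are non-empty, convex and bounded for all $k\in\mathcal K$, $i\in\mathcal N$. (2) The matrices $\partial h_k/\partial v_k^i$ have full rank for all $k\in\mathcal K$, $i\in\mathcal N$. (3) $g_k^i(x_k,\mathbf u_k,\mathbf v_k)=gu_k^i(x_k,\mathbf u_k)+gv_k^i(x_k,\mathbf v_k)$ for $k\in\mathcal K\setminus\{K\}$. (4) $f_k$, $h_k$ and $g_k^i$ are twice continuously differentiable in their arguments (on the whole Euclidean spaces). *)

theory Defs
  imports "HOL-Analysis.Analysis"
begin

text \<open>
  Players form a finite type \<open>'i\<close>.  The numbers \<open>m_i\<close> may differ from player to player, so the
  joint space \<open>R^m\<close> is \<open>real ^ 'm\<close> together with a map \<open>own :: 'm \<Rightarrow> 'i\<close> saying which player each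
  coordinate belongs to.  Player \<open>i\<close>'s space \<open>R^{m_i}\<close>, with \<open>m_i = card {c. own c = i}\<close>, is the
  coordinate subspace \<open>block own i\<close>; every family \<open>(m_i)\<close> with positive sum arises in this way.
  The same encoding is used for \<open>R^s\<close>.
\<close>

definition block :: "('m \<Rightarrow> 'i) \<Rightarrow> 'i \<Rightarrow> (real ^ 'm) set" where
  "block own i = {a. \<forall>c. own c \<noteq> i \<longrightarrow> a $ c = 0}"

definition component :: "('m \<Rightarrow> 'i) \<Rightarrow> 'i \<Rightarrow> real ^ 'm \<Rightarrow> real ^ 'm" where
  "component own i w = (\<chi> c. if own c = i then w $ c else 0)"

text \<open>\<open>replace own i a w\<close> is the profile \<open>(a, w^{-i})\<close>; it does not depend on the coordinates of
  \<open>a\<close> outside player \<open>i\<close>'s block.\<close>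

definition replace :: "('m \<Rightarrow> 'i) \<Rightarrow> 'i \<Rightarrow> real ^ 'm \<Rightarrow> real ^ 'm \<Rightarrow> real ^ 'm" where
  "replace own i a w = (\<chi> c. if own c = i then a $ c else w $ c)"

text \<open>The partial derivative of \<open>F\<close> at \<open>w\<close> with respect to the block \<open>w^i\<close>, as a linear map on
  \<open>R^m\<close> that vanishes on the coordinates of the other players.\<close>

definition block_deriv ::
  "('m \<Rightarrow> 'i) \<Rightarrow> 'i \<Rightarrow> (real ^ 'm \<Rightarrow> 'b::real_normed_vector) \<Rightarrow> real ^ 'm \<Rightarrow> real ^ 'm \<Rightarrow> 'b" where
  "block_deriv own i F w = frechet_derivative (\<lambda>a. F (replace own i a w)) (at w)"

definition twice_cont_diff ::
  "('a::real_normed_vector \<Rightarrow> 'b::real_normed_vector) \<Rightarrow> bool" where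
  "twice_cont_diff F \<longleftrightarrow>
     (\<exists>(F' :: 'a \<Rightarrow> 'a \<Rightarrow>\<^sub>L 'b) (F'' :: 'a \<Rightarrow> 'a \<Rightarrow>\<^sub>L ('a \<Rightarrow>\<^sub>L 'b)).
        (\<forall>x. (F has_derivative blinfun_apply (F' x)) (at x)) \<and>
        (\<forall>x. (F' has_derivative blinfun_apply (F'' x)) (at x)) \<and>
        continuous_on UNIV F'')"

text \<open>
  The data of the difference game.  Sequences over time are total functions on \<open>nat\<close>; only the
  values at \<open>k < horizon\<close> (for \<open>u\<close>, \<open>dyn\<close>, \<open>Uset\<close>, \<open>rcost\<close>) or \<open>k \<le> horizon\<close> (for \<open>v\<close>, \<open>Xset\<close>,
  \<open>Vset\<close>, \<open>hcon\<close>, \<open>rows\<close>) are ever used.  The number of components of \<open>h_k\<close> may depend on \<open>k\<close>: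
  \<open>rows k\<close> is the index set of the components of \<open>h_k\<close>, and \<open>hcon k\<close> vanishes identically in all
  other coordinates of \<open>real ^ 'c\<close>.
\<close>

record ('i, 'n::finite, 'm::finite, 's::finite, 'c::finite) nzdg =
  horizon :: nat
  uown :: "'m \<Rightarrow> 'i"
  vown :: "'s \<Rightarrow> 'i"
  init :: "real ^ 'n"
  Xset :: "nat \<Rightarrow> (real ^ 'n) set"
  Uset :: "nat \<Rightarrow> 'i \<Rightarrow> (real ^ 'm) set"
  Vset :: "nat \<Rightarrow> 'i \<Rightarrow> (real ^ 's) set"
  dyn :: "nat \<Rightarrow> real ^ 'n \<Rightarrow> real ^ 'm \<Rightarrow> real ^ 'n"
  rows :: "nat \<Rightarrow> 'c set"
  hcon :: "nat \<Rightarrow> real ^ 'n \<Rightarrow> real ^ 's \<Rightarrow> real ^ 'c"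
  rcost :: "nat \<Rightarrow> 'i \<Rightarrow> real ^ 'n \<Rightarrow> real ^ 'm \<Rightarrow> real ^ 's \<Rightarrow> real"
  tcost :: "'i \<Rightarrow> real ^ 'n \<Rightarrow> real ^ 's \<Rightarrow> real"

definition well_formed :: "('i, 'n::finite, 'm::finite, 's::finite, 'c::finite) nzdg \<Rightarrow> bool" where
  "well_formed G \<longleftrightarrow>
     (\<forall>k < horizon G. \<forall>i. Uset G k i \<subseteq> block (uown G) i) \<and>
     (\<forall>k \<le> horizon G. \<forall>i. Vset G k i \<subseteq> block (vown G) i) \<and>
     (\<forall>k \<le> horizon G. \<forall>x v. \<forall>r. r \<notin> rows G k \<longrightarrow> hcon G k x v $ r = 0)"

primrec state :: "('i, 'n::finite, 'm::finite, 's::finite, 'c::finite) nzdg \<Rightarrow>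
    (nat \<Rightarrow> real ^ 'm) \<Rightarrow> nat \<Rightarrow> real ^ 'n" where
  "state G u 0 = init G"
| "state G u (Suc k) = dyn G k (state G u k) (u k)"

definition admissible :: "('i, 'n::finite, 'm::finite, 's::finite, 'c::finite) nzdg \<Rightarrow>
    (nat \<Rightarrow> real ^ 'm) \<Rightarrow> (nat \<Rightarrow> real ^ 's) \<Rightarrow> bool" where
  "admissible G u v \<longleftrightarrow>
     (\<forall>k < horizon G. \<forall>i. component (uown G) i (u k) \<in> Uset G k i) \<and>
     (\<forall>k \<le> horizon G. \<forall>i. component (vown G) i (v k) \<in> Vset G k i) \<and>
     (\<forall>k \<le> horizon G. state G u k \<in> Xset G k) \<and>
     (\<forall>k \<le> horizon G. 0 \<le> hcon G k (state G u k) (v k) \<and> 0 \<le> v k)"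

definition total_cost :: "('i, 'n::finite, 'm::finite, 's::finite, 'c::finite) nzdg \<Rightarrow>
    (nat \<Rightarrow> real ^ 'n \<Rightarrow> real ^ 'm \<Rightarrow> real ^ 's \<Rightarrow> real) \<Rightarrow> (real ^ 'n \<Rightarrow> real ^ 's \<Rightarrow> real) \<Rightarrow>
    (nat \<Rightarrow> real ^ 'm) \<Rightarrow> (nat \<Rightarrow> real ^ 's) \<Rightarrow> real" where
  "total_cost G L LK u v =
     LK (state G u (horizon G)) (v (horizon G)) + (\<Sum>k < horizon G. L k (state G u k) (u k) (v k))"

definition player_cost :: "('i, 'n::finite, 'm::finite, 's::finite, 'c::finite) nzdg \<Rightarrow> 'i \<Rightarrow>
    (nat \<Rightarrow> real ^ 'm) \<Rightarrow> (nat \<Rightarrow> real ^ 's) \<Rightarrow> real" where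
  "player_cost G i = total_cost G (\<lambda>k. rcost G k i) (tcost G i)"

definition open_loop_nash :: "('i, 'n::finite, 'm::finite, 's::finite, 'c::finite) nzdg \<Rightarrow>
    (nat \<Rightarrow> real ^ 'm) \<Rightarrow> (nat \<Rightarrow> real ^ 's) \<Rightarrow> bool" where
  "open_loop_nash G u v \<longleftrightarrow>
     admissible G u v \<and>
     (\<forall>i a b. (\<forall>k. a k \<in> block (uown G) i) \<longrightarrow> (\<forall>k. b k \<in> block (vown G) i) \<longrightarrow>
        (let u' = (\<lambda>k. replace (uown G) i (a k) (u k));
             v' = (\<lambda>k. replace (vown G) i (b k) (v k))
         in admissible G u' v' \<longrightarrow> player_cost G i u v \<le> player_cost G i u' v'))"

definition ocp_optimal :: "('i, 'n::finite, 'm::finite, 's::finite, 'c::finite) nzdg \<Rightarrow>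
    (nat \<Rightarrow> real ^ 'n \<Rightarrow> real ^ 'm \<Rightarrow> real ^ 's \<Rightarrow> real) \<Rightarrow> (real ^ 'n \<Rightarrow> real ^ 's \<Rightarrow> real) \<Rightarrow>
    (nat \<Rightarrow> real ^ 'm) \<Rightarrow> (nat \<Rightarrow> real ^ 's) \<Rightarrow> bool" where
  "ocp_optimal G P PK u v \<longleftrightarrow>
     admissible G u v \<and>
     (\<forall>u' v'. admissible G u' v' \<longrightarrow> total_cost G P PK u v \<le> total_cost G P PK u' v')"

definition ocp_costs :: "('i, 'n::finite, 'm::finite, 's::finite, 'c::finite) nzdg \<Rightarrow>
    (nat \<Rightarrow> real ^ 'n \<Rightarrow> real ^ 'm \<Rightarrow> real ^ 's \<Rightarrow> real) \<Rightarrow> (real ^ 'n \<Rightarrow> real ^ 's \<Rightarrow> real) \<Rightarrow>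
    bool" where
  "ocp_costs G P PK \<longleftrightarrow>
     (\<forall>k < horizon G. twice_cont_diff (\<lambda>(x, u, v). P k x u v)) \<and>
     twice_cont_diff (\<lambda>(x, v). PK x v)"

text \<open>Existence of an optimal solution is part of the definition, so that costs for which the
  optimal control problem is unsolvable do not count as potential functions vacuously.\<close>

definition potential_functions :: "('i, 'n::finite, 'm::finite, 's::finite, 'c::finite) nzdg \<Rightarrow>
    (nat \<Rightarrow> real ^ 'n \<Rightarrow> real ^ 'm \<Rightarrow> real ^ 's \<Rightarrow> real) \<Rightarrow> (real ^ 'n \<Rightarrow> real ^ 's \<Rightarrow> real) \<Rightarrow>
    bool" where
  "potential_functions G P PK \<longleftrightarrow>
     ocp_costs G P PK \<and>
     (\<exists>u v. ocp_optimal G P PK u v) \<and>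
     (\<forall>u v. ocp_optimal G P PK u v \<longrightarrow> open_loop_nash G u v)"

definition OLPDG :: "('i, 'n::finite, 'm::finite, 's::finite, 'c::finite) nzdg \<Rightarrow> bool" where
  "OLPDG G \<longleftrightarrow> (\<exists>P PK. potential_functions G P PK)"

definition feasible_actions :: "('i, 'n::finite, 'm::finite, 's::finite, 'c::finite) nzdg \<Rightarrow>
    nat \<Rightarrow> 'i \<Rightarrow> real ^ 'n \<Rightarrow> real ^ 's \<Rightarrow> (real ^ 's) set" where
  "feasible_actions G k i x v =
     {a \<in> block (vown G) i. 0 \<le> hcon G k x (replace (vown G) i a v) \<and> 0 \<le> replace (vown G) i a v}"

text \<open>The feasible action set is empty when some rival's action has a negative coordinate, so the
  rivals' actions range over the nonnegative elements of their action sets.\<close>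

definition convex_feasibility ::
  "('i, 'n::finite, 'm::finite, 's::finite, 'c::finite) nzdg \<Rightarrow> bool" where
  "convex_feasibility G \<longleftrightarrow>
     (\<forall>k \<le> horizon G. convex (Xset G k) \<and>
        (\<forall>i. \<forall>x \<in> Xset G k. \<forall>v.
           (\<forall>j. j \<noteq> i \<longrightarrow> component (vown G) j v \<in> Vset G k j \<and> 0 \<le> component (vown G) j v) \<longrightarrow>
           feasible_actions G k i x v \<noteq> {} \<and>
           convex (feasible_actions G k i x v) \<and>
           bounded (feasible_actions G k i x v)))"

text \<open>The matrix below is the Jacobian of \<open>h_k\<close> with respect to \<open>v_k^i\<close>, bordered by zero columns
  for the other players and zero rows for the indices outside \<open>rows k\<close>; this does not change its
  rank.\<close>

definition full_rank_constraints ::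
  "('i, 'n::finite, 'm::finite, 's::finite, 'c::finite) nzdg \<Rightarrow> bool" where
  "full_rank_constraints G \<longleftrightarrow>
     (\<forall>k \<le> horizon G. \<forall>i. \<forall>x \<in> Xset G k. \<forall>v.
        (\<forall>j. component (vown G) j v \<in> Vset G k j) \<and> 0 \<le> hcon G k x v \<and> 0 \<le> v \<longrightarrow>
        rank (matrix (block_deriv (vown G) i (hcon G k x) v))
          = min (card (rows G k)) (card {c. vown G c = i}))"

definition separable_costs :: "('i, 'n::finite, 'm::finite, 's::finite, 'c::finite) nzdg \<Rightarrow>
    (nat \<Rightarrow> 'i \<Rightarrow> real ^ 'n \<Rightarrow> real ^ 'm \<Rightarrow> real) \<Rightarrow>
    (nat \<Rightarrow> 'i \<Rightarrow> real ^ 'n \<Rightarrow> real ^ 's \<Rightarrow> real) \<Rightarrow> bool" where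
  "separable_costs G gu gv \<longleftrightarrow>
     (\<forall>k < horizon G. \<forall>i x u v. rcost G k i x u v = gu k i x u + gv k i x v)"

definition smooth_data :: "('i, 'n::finite, 'm::finite, 's::finite, 'c::finite) nzdg \<Rightarrow> bool" where
  "smooth_data G \<longleftrightarrow>
     (\<forall>k < horizon G. twice_cont_diff (\<lambda>(x, u). dyn G k x u)) \<and>
     (\<forall>k \<le> horizon G. twice_cont_diff (\<lambda>(x, v). hcon G k x v)) \<and>
     (\<forall>k < horizon G. \<forall>i. twice_cont_diff (\<lambda>(x, u, v). rcost G k i x u v)) \<and>
     (\<forall>i. twice_cont_diff (\<lambda>(x, v). tcost G i x v))"

end

theory Submission
  imports Defs
begin

text \<open>
  For each player \<open>i\<close> the difference \<open>P\<^sub>k - g\<^sub>k\<^sup>i\<close> has vanishing partial derivatives in the state and in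
  player \<open>i\<close>'s own actions, so it depends on the rivals' actions only.  The difference between the
  OCP cost and player \<open>i\<close>'s cost is therefore unchanged by a unilateral deviation, even though
  the deviation alters the trajectory.  Since the profile is optimal against all admissible
  profiles, it is in particular optimal against the admissible unilateral deviations.
\<close>

lemma replace_self [simp]: "replace own i w w = w"
  by (simp add: replace_def vec_eq_iff)

lemma replace_replace [simp]: "replace own i a (replace own i b w) = replace own i a w"
  by (simp add: replace_def vec_eq_iff)

lemma replace_replace_inner [simp]: "replace own i (replace own i a w') w = replace own i a w"
  by (simp add: replace_def vec_eq_iff)

text \<open>In its first argument \<open>replace\<close> is affine: the projection
  \<open>component own i\<close> plus a constant made of the rivals' coordinates of
  \<open>w\<close>.\<close>

lemma differentiable_replace:
  fixes own :: "'m::finite \<Rightarrow> 'i"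
  shows "(\<lambda>a. replace own i a w) differentiable at x"
proof -
  have "linear (component own i)"
    by (rule linearI) (simp_all add: component_def vec_eq_iff)
  then have "(\<lambda>a. component own i a + (w - component own i w)) differentiable at x"
    by (intro differentiable_add differentiable_const linear_imp_differentiable)
  moreover have "(\<lambda>a. replace own i a w) = (\<lambda>a. component own i a + (w - component own i w))"
    by (auto simp: replace_def component_def vec_eq_iff)
  ultimately show ?thesis by simp
qed

lemma convex_range_replace:
  fixes own :: "'m::finite \<Rightarrow> 'i"
  shows "convex (range (\<lambda>a. replace own i a w))"
proof (rule convexI)
  fix x y and s t :: real
  assume "x \<in> range (\<lambda>a. replace own i a w)" "y \<in> range (\<lambda>a. replace own i a w)"
    and st: "s + t = 1"
  then obtain a b where "x = replace own i a w" "y = replace own i b w" by blast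
  \<comment> \<open>\<open>x\<close> and \<open>y\<close> share the rivals' coordinates of
    \<open>w\<close>; weights summing to 1 leave these fixed.\<close>
  moreover have "s * c + t * c = c" for c
    using st by (metis distrib_right mult_1)
  ultimately have "s *\<^sub>R x + t *\<^sub>R y = replace own i (s *\<^sub>R a + t *\<^sub>R b) w"
    by (simp add: replace_def vec_eq_iff)
  then show "s *\<^sub>R x + t *\<^sub>R y \<in> range (\<lambda>a. replace own i a w)" by blast
qed

text \<open>The difference \<open>F - H\<close> has zero derivative on the convex set
  \<open>S\<close>, hence is constant there. The set is a parameter because the derivatives may be
  known to agree only on a slice of the space.\<close>

lemma equal_frechet_derivative_diff_constant:
  fixes F H :: "'a::real_normed_vector \<Rightarrow> 'b::real_normed_vector"
  assumes "convex S"
    and "\<And>x. x \<in> S \<Longrightarrow> F differentiable at x"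
    and "\<And>x. x \<in> S \<Longrightarrow> H differentiable at x"
    and "\<And>x. x \<in> S \<Longrightarrow> frechet_derivative F (at x) = frechet_derivative H (at x)"
    and "x \<in> S" "y \<in> S"
  shows "F x - H x = F y - H y"
proof -
  have "((\<lambda>x. F x - H x) has_derivative (\<lambda>h. 0)) (at z within S)" if "z \<in> S" for z
  proof -
    have "((\<lambda>x. F x - H x) has_derivative
        (\<lambda>h. frechet_derivative F (at z) h - frechet_derivative H (at z) h)) (at z)"
      using assms(2,3) that by (intro has_derivative_diff) (simp_all flip: frechet_derivative_works)
    then show ?thesis
      using assms(4)[OF that] by (simp add: has_derivative_at_withinI)
  qed
  then obtain c where "\<And>z. z \<in> S \<Longrightarrow> F z - H z = c"
    using has_derivative_zero_constant[OF assms(1), of "\<lambda>x. F x - H x"] by blast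
  then show ?thesis using assms(5,6) by simp
qed

text \<open>Moving player \<open>i\<close>'s block stays in the affine slice through
  \<open>w\<close> on which the rivals' coordinates are fixed. Equality of the block derivatives
  along this slice makes \<open>F - H\<close> constant on it.\<close>

lemma equal_block_deriv_diff_replace:
  fixes F H :: "real ^ 'm::finite \<Rightarrow> 'b::real_normed_vector"
  assumes F: "\<And>w. F differentiable at w"
    and H: "\<And>w. H differentiable at w"
    and deriv: "\<And>w. block_deriv own i F w = block_deriv own i H w"
  shows "F (replace own i a w) - H (replace own i a w) = F w - H w"
proof -
  let ?S = "range (\<lambda>a. replace own i a w)"
  have "frechet_derivative (\<lambda>a. F (replace own i a w)) (at z)
      = frechet_derivative (\<lambda>a. H (replace own i a w)) (at z)" if "z \<in> ?S" for z
    \<comment> \<open>For \<open>z\<close> in the slice,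
      \<open>replace own i a z = replace own i a w\<close>, so the block derivative based at
      \<open>z\<close> is the derivative at \<open>z\<close> of the map based at
      \<open>w\<close>.\<close>
    using deriv[of z] that by (auto simp: block_deriv_def)
  moreover have "(\<lambda>a. F (replace own i a w)) differentiable at z"
    "(\<lambda>a. H (replace own i a w)) differentiable at z" for z
    using differentiable_chain_at[OF differentiable_replace F]
      differentiable_chain_at[OF differentiable_replace H] by (simp_all add: o_def)
  moreover have "replace own i a w \<in> ?S" by blast
  moreover have "w \<in> ?S" by (rule range_eqI[of _ _ w]) simp
  ultimately have "F (replace own i (replace own i a w) w) - H (replace own i (replace own i a w) w)
      = F (replace own i w w) - H (replace own i w w)"
    by (intro equal_frechet_derivative_diff_constant[OF convex_range_replace[of own i w]]) assumption+
  then show ?thesis by simp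
qed

lemma twice_cont_diff_differentiable_comp:
  assumes "twice_cont_diff F" "f differentiable at x"
  shows "(\<lambda>y. F (f y)) differentiable at x"
proof -
  have "F differentiable at (f x)"
    using assms(1) unfolding twice_cont_diff_def differentiable_def by blast
  then show ?thesis
    using differentiable_chain_at[OF assms(2)] by (simp add: o_def)
qed

lemma differentiable_Pair:
  assumes "f differentiable at x within S" "g differentiable at x within S"
  shows "(\<lambda>y. (f y, g y)) differentiable at x within S"
  using assms has_derivative_Pair unfolding differentiable_def by blast

text \<open>Freezing one argument is composition with the affine embedding
  \<open>y \<mapsto> (y, v)\<close> or \<open>y \<mapsto> (x, y)\<close>.\<close>

lemma twice_cont_diff_pairD:
  assumes "twice_cont_diff (\<lambda>(x, v). F x v)"
  shows "(\<lambda>y. F y v) differentiable at x" "F x differentiable at v"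
  using twice_cont_diff_differentiable_comp[OF assms, of "\<lambda>y. (y, v)"]
    twice_cont_diff_differentiable_comp[OF assms, of "\<lambda>y. (x, y)"]
  by (simp_all add: differentiable_Pair)

lemma twice_cont_diff_tripleD:
  assumes "twice_cont_diff (\<lambda>(x, u, v). F x u v)"
  shows "(\<lambda>y. F y u v) differentiable at x"
    "(\<lambda>y. F x y v) differentiable at u"
    "F x u differentiable at v"
  using twice_cont_diff_differentiable_comp[OF assms, of "\<lambda>y. (y, u, v)"]
    twice_cont_diff_differentiable_comp[OF assms, of "\<lambda>y. (x, y, v)"]
    twice_cont_diff_differentiable_comp[OF assms, of "\<lambda>y. (x, u, y)"]
  by (simp_all add: differentiable_Pair)

text \<open>The arguments are exchanged one at a time: first the state, then player
  \<open>i\<close>'s block of \<open>u\<close>, then that of \<open>v\<close>. The states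
  \<open>x'\<close> and \<open>x\<close> are unrelated, so that they can later be taken from two
  different trajectories.\<close>

lemma stage_difference_invariant:
  fixes P :: "'x::real_normed_vector \<Rightarrow> real ^ 'm::finite \<Rightarrow> real ^ 's::finite \<Rightarrow> real"
  assumes P: "twice_cont_diff (\<lambda>(x, u, v). P x u v)"
    and g: "twice_cont_diff (\<lambda>(x, u, v). g x u v)"
    and sep: "\<And>x u v. g x u v = gu x u + gv x v"
    and du: "\<And>x u v. block_deriv ou i (\<lambda>w. P x w v) u = block_deriv ou i (gu x) u"
    and dv: "\<And>x u v. block_deriv ov i (P x u) v = block_deriv ov i (gv x) v"
    and dx: "\<And>x u v. frechet_derivative (\<lambda>y. P y u v) (at x) = frechet_derivative (\<lambda>y. g y u v) (at x)"
  shows "P x' (replace ou i a u) (replace ov i b v) - g x' (replace ou i a u) (replace ov i b v)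
    = P x u v - g x u v"
proof -
  note dP = twice_cont_diff_tripleD[OF P] and dg = twice_cont_diff_tripleD[OF g]
  let ?u = "replace ou i a u" and ?v = "replace ov i b v"
  \<comment> \<open>Smoothness is given for the sum \<open>g\<close> only; \<open>gu x\<close> is
    recovered as \<open>g x u 0 - gv x 0\<close>, with 0 as an arbitrary frozen action, and
    \<open>gv x\<close> likewise.\<close>
  have dgu: "gu x differentiable at u" for x u
    using differentiable_diff[OF dg(2)[of x 0 u] differentiable_const[of "gv x 0"]]
    by (simp add: sep)
  have dgv: "gv x differentiable at v" for x v
    using differentiable_diff[OF dg(3)[of x 0 v] differentiable_const[of "gu x 0"]]
    by (simp add: sep)
  have "P x' ?u ?v - g x' ?u ?v = P x ?u ?v - g x ?u ?v"
    using equal_frechet_derivative_diff_constant[of UNIV "\<lambda>y. P y ?u ?v" "\<lambda>y. g y ?u ?v" x' x]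
    by (simp add: dP(1) dg(1) dx)
  moreover have "P x ?u ?v - gu x ?u = P x u ?v - gu x u"
    by (rule equal_block_deriv_diff_replace[OF dP(2) dgu du])
  moreover have "P x u ?v - gv x ?v = P x u v - gv x v"
    by (rule equal_block_deriv_diff_replace[OF dP(3) dgv dv])
  \<comment> \<open>Splitting \<open>g\<close> by \<open>sep\<close>, the summand that each exchange
    leaves alone, \<open>gv x ?v\<close> and then \<open>gu x u\<close>, is the same on both sides
    and cancels.\<close>
  ultimately show ?thesis by (simp add: sep)
qed

text \<open>With no control at the final time, two exchanges suffice: the state, then player
  \<open>i\<close>'s block of \<open>v\<close>.\<close>

lemma terminal_difference_invariant:
  fixes P :: "'x::real_normed_vector \<Rightarrow> real ^ 's::finite \<Rightarrow> real"
  assumes P: "twice_cont_diff (\<lambda>(x, v). P x v)"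
    and g: "twice_cont_diff (\<lambda>(x, v). g x v)"
    and dv: "\<And>x v. block_deriv ov i (P x) v = block_deriv ov i (g x) v"
    and dx: "\<And>x v. frechet_derivative (\<lambda>y. P y v) (at x) = frechet_derivative (\<lambda>y. g y v) (at x)"
  shows "P x' (replace ov i b v) - g x' (replace ov i b v) = P x v - g x v"
proof -
  note dP = twice_cont_diff_pairD[OF P] and dg = twice_cont_diff_pairD[OF g]
  let ?v = "replace ov i b v"
  have "P x' ?v - g x' ?v = P x ?v - g x ?v"
    using equal_frechet_derivative_diff_constant[of UNIV "\<lambda>y. P y ?v" "\<lambda>y. g y ?v" x' x]
    by (simp add: dP(1) dg(1) dx)
  also have "\<dots> = P x v - g x v"
    by (rule equal_block_deriv_diff_replace[OF dP(2) dg(2) dv])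
  finally show ?thesis .
qed

theorem theorem3p8:
  fixes G :: "('i::finite, 'n::finite, 'm::finite, 's::finite, 'c::finite) nzdg"
    and gu :: "nat \<Rightarrow> 'i \<Rightarrow> real ^ 'n \<Rightarrow> real ^ 'm \<Rightarrow> real"
    and gv :: "nat \<Rightarrow> 'i \<Rightarrow> real ^ 'n \<Rightarrow> real ^ 's \<Rightarrow> real"
    and P :: "nat \<Rightarrow> real ^ 'n \<Rightarrow> real ^ 'm \<Rightarrow> real ^ 's \<Rightarrow> real"
    and PK :: "real ^ 'n \<Rightarrow> real ^ 's \<Rightarrow> real"
    and us :: "nat \<Rightarrow> real ^ 'm"
    and vs :: "nat \<Rightarrow> real ^ 's"
  assumes "well_formed G"
    and "convex_feasibility G"
    and "full_rank_constraints G"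
    and "separable_costs G gu gv"
    and "smooth_data G"
    and "ocp_costs G P PK"
    and "\<And>k i x u v. k < horizon G \<Longrightarrow>
           block_deriv (uown G) i (\<lambda>w. P k x w v) u = block_deriv (uown G) i (gu k i x) u"
    and "\<And>k i x u v. k < horizon G \<Longrightarrow>
           block_deriv (vown G) i (P k x u) v = block_deriv (vown G) i (gv k i x) v"
    and "\<And>k i x u v. k < horizon G \<Longrightarrow>
           frechet_derivative (\<lambda>y. P k y u v) (at x)
             = frechet_derivative (\<lambda>y. rcost G k i y u v) (at x)"
    and "\<And>i x v. frechet_derivative (\<lambda>y. PK y v) (at x)
             = frechet_derivative (\<lambda>y. tcost G i y v) (at x)"
    and "\<And>i x v. block_deriv (vown G) i (PK x) v = block_deriv (vown G) i (tcost G i x) v"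
    and "ocp_optimal G P PK us vs"
  shows "open_loop_nash G us vs \<and> potential_functions G P PK \<and> OLPDG G"
proof -
  have P: "twice_cont_diff (\<lambda>(x, u, v). P k x u v)" if "k < horizon G" for k
    using assms(6) that by (simp add: ocp_costs_def)
  have PK: "twice_cont_diff (\<lambda>(x, v). PK x v)"
    using assms(6) by (simp add: ocp_costs_def)
  have g: "twice_cont_diff (\<lambda>(x, u, v). rcost G k i x u v)" if "k < horizon G" for k i
    using assms(5) that by (simp add: smooth_data_def)
  have gK: "twice_cont_diff (\<lambda>(x, v). tcost G i x v)" for i
    using assms(5) by (simp add: smooth_data_def)
  have sep: "rcost G k i x u v = gu k i x u + gv k i x v" if "k < horizon G" for k i x u v
    using assms(4) that by (simp add: separable_costs_def)
  \<comment> \<open>Proved for every optimal pair rather than for \<open>us\<close>,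
    \<open>vs\<close> alone, as \<open>potential_functions\<close> quantifies over all optimal
    solutions.\<close>
  have nash: "open_loop_nash G u v" if opt: "ocp_optimal G P PK u v" for u v
    unfolding open_loop_nash_def Let_def
  proof (intro conjI allI impI)
    show "admissible G u v" using opt by (simp add: ocp_optimal_def)
    fix i a b
    let ?u = "\<lambda>k. replace (uown G) i (a k) (u k)" and ?v = "\<lambda>k. replace (vown G) i (b k) (v k)"
    assume "admissible G ?u ?v"
    then have "total_cost G P PK u v \<le> total_cost G P PK ?u ?v"
      using opt by (simp add: ocp_optimal_def)
    moreover have "total_cost G P PK ?u ?v - player_cost G i ?u ?v
        = total_cost G P PK u v - player_cost G i u v"
    proof -
      \<comment> \<open>The stage lemma is instantiated with \<open>x'\<close> on the deviated
        trajectory and \<open>x\<close> on the original one.\<close>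
      have "P k (state G ?u k) (?u k) (?v k) - rcost G k i (state G ?u k) (?u k) (?v k)
          = P k (state G u k) (u k) (v k) - rcost G k i (state G u k) (u k) (v k)"
        if "k < horizon G" for k
        by (rule stage_difference_invariant[OF P[OF that] g[OF that] sep[OF that]
            assms(7)[OF that] assms(8)[OF that] assms(9)[OF that]])
      then have "(\<Sum>k<horizon G. P k (state G ?u k) (?u k) (?v k)
            - rcost G k i (state G ?u k) (?u k) (?v k))
          = (\<Sum>k<horizon G. P k (state G u k) (u k) (v k)
            - rcost G k i (state G u k) (u k) (v k))"
        by (intro sum.cong) auto
      moreover have "PK (state G ?u (horizon G)) (?v (horizon G))
            - tcost G i (state G ?u (horizon G)) (?v (horizon G))
          = PK (state G u (horizon G)) (v (horizon G))
            - tcost G i (state G u (horizon G)) (v (horizon G))"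
        by (rule terminal_difference_invariant[OF PK gK assms(11) assms(10)])
      ultimately show ?thesis
        by (simp add: player_cost_def total_cost_def sum_subtractf)
    qed
    ultimately show "player_cost G i u v \<le> player_cost G i ?u ?v" by linarith
  qed
  \<comment> \<open>The pair \<open>us\<close>, \<open>vs\<close> witnesses the solvability of the
    control problem that the definition demands.\<close>
  then have "potential_functions G P PK"
    using assms(6,12) unfolding potential_functions_def by blast
  then show ?thesis
    using nash[OF assms(12)] unfolding OLPDG_def by blast
qed

end
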